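(* Let $(A,\star,\alpha)$ be a hom-associative structure with $\alpha : A \to A$ surjective. Then at least one of the following holds: (1) $A$ is a twist, i.e. there is an associative binary operation $\cdot : A\times A\to A$ such that $x\star y=\alpha(x\cdot y)$ for all $x,y\in A$; (2) $(A,\star)$ is strongly degenerate, i.e. there exist $a\neq b$ in $A$ such that $x\star a=x\star b$ and $a\star x=b\star x$ for all $x\in A$.
   Context: A hom-associative structure $(A,\star,\alpha)$ is a set $A$ together with a binary operation $\star:A\times A\to A$ and a map $\alpha:A\to A$ such that $\alpha(x)\star(y\star z)=(x\star y)\star\alpha(z)$ for all $x,y,z\in A$. No further structure on $A$ and no compatibility of $\alpha$ with $\star$ other than this identity is assumed. *)

theory Defs
  imports "HOL-Library.FuncSet"
begin

(* The underlying set is an explicit carrier A, possibly empty; the values of the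
   operations outside A are irrelevant. *)

definition hom_associative :: "'a set \<Rightarrow> ('a \<Rightarrow> 'a \<Rightarrow> 'a) \<Rightarrow> ('a \<Rightarrow> 'a) \<Rightarrow> bool" where
  "hom_associative A star \<alpha> \<longleftrightarrow>
     star \<in> A \<rightarrow> A \<rightarrow> A \<and> \<alpha> \<in> A \<rightarrow> A \<and>
     (\<forall>x\<in>A. \<forall>y\<in>A. \<forall>z\<in>A. star (\<alpha> x) (star y z) = star (star x y) (\<alpha> z))"

definition associative_on :: "'a set \<Rightarrow> ('a \<Rightarrow> 'a \<Rightarrow> 'a) \<Rightarrow> bool" where
  "associative_on A m \<longleftrightarrow>
     m \<in> A \<rightarrow> A \<rightarrow> A \<and> (\<forall>x\<in>A. \<forall>y\<in>A. \<forall>z\<in>A. m (m x y) z = m x (m y z))"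

definition is_twist :: "'a set \<Rightarrow> ('a \<Rightarrow> 'a \<Rightarrow> 'a) \<Rightarrow> ('a \<Rightarrow> 'a) \<Rightarrow> bool" where
  "is_twist A star \<alpha> \<longleftrightarrow>
     (\<exists>m. associative_on A m \<and> (\<forall>x\<in>A. \<forall>y\<in>A. star x y = \<alpha> (m x y)))"

definition strongly_degenerate :: "'a set \<Rightarrow> ('a \<Rightarrow> 'a \<Rightarrow> 'a) \<Rightarrow> bool" where
  "strongly_degenerate A star \<longleftrightarrow>
     (\<exists>a\<in>A. \<exists>b\<in>A. a \<noteq> b \<and> (\<forall>x\<in>A. star x a = star x b \<and> star a x = star b x))"

end

theory Submission
  imports Defs
begin

text \<open>
  Suppose that \<open>(A, \<star>)\<close> is not strongly degenerate, so that an element is determined by its left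
  and right translations; since \<open>\<alpha>\<close> is surjective, translations by elements \<open>\<alpha> x\<close> suffice. Both
  halves of the proof compare two elements by testing them against all \<open>\<alpha> u\<close> from either side:
  on elements that are themselves products the hom-associative law applies to the tests, and
  elements that are not products are reached by multiplying them up first.

  The first half shows that \<open>\<alpha>\<close> is injective (lemma \<open>inj_on_\<alpha>\<close>). Hence \<open>x \<cdot> y = \<alpha>\<inverse> (x \<star> y)\<close> is
  well defined and satisfies \<open>x \<star> y = \<alpha> (x \<cdot> y)\<close>, and cancelling one \<open>\<alpha>\<close> in the hom-associative
  law leaves \<open>[x] [y z] = [x y] [z]\<close>, where \<open>[x]\<close> stands for \<open>\<alpha> x\<close> and juxtaposition for \<open>\<cdot>\<close>.

  The second half deduces that \<open>\<cdot>\<close> is associative. As \<open>\<alpha>\<close> is injective, elements may be compared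
  after applying \<open>\<alpha>\<close>, which is what makes the bracket law applicable to their tests. Tested
  against \<open>[t]\<close> from the right, \<open>[(x y) z]\<close> and \<open>[x (y z)]\<close> give \<open>[(x y) z] [t] = [x y] [z t]\<close> and
  \<open>[x (y z)] [t]\<close>. These two products are equal, because applying \<open>\<alpha>\<close> and testing from the left
  once more reduces both to the same expression:
  \<open>[[v]] [[x y] [z t]] = [[v x] [y z]] [[t]] = [[v]] [[x (y z)] [t]]\<close>
  (lemma \<open>bracket_left_test\<close>). Everything else is left-right symmetry, obtained by passing to the
  opposite operation.
\<close>

section \<open>Injectivity of the twisting map\<close>

locale faithful_hom_associative =
  fixes A :: "'a set" and star :: "'a \<Rightarrow> 'a \<Rightarrow> 'a" (infixl "\<star>" 70) and \<alpha> :: "'a \<Rightarrow> 'a"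
  assumes star_closed: "\<lbrakk>x \<in> A; y \<in> A\<rbrakk> \<Longrightarrow> x \<star> y \<in> A"
    and \<alpha>_image: "\<alpha> ` A = A"
    and hom_assoc: "\<lbrakk>x \<in> A; y \<in> A; z \<in> A\<rbrakk> \<Longrightarrow> \<alpha> x \<star> (y \<star> z) = (x \<star> y) \<star> \<alpha> z"
    and faithful: "\<lbrakk>a \<in> A; b \<in> A; \<And>x. x \<in> A \<Longrightarrow> x \<star> a = x \<star> b; \<And>x. x \<in> A \<Longrightarrow> a \<star> x = b \<star> x\<rbrakk>
      \<Longrightarrow> a = b"
begin

lemma \<alpha>_closed: "x \<in> A \<Longrightarrow> \<alpha> x \<in> A"
  using imageI[of x A \<alpha>] by (simp add: \<alpha>_image)

lemma preimage:
  assumes "w \<in> A"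
  obtains z where "z \<in> A" "w = \<alpha> z"
  using assms \<alpha>_image by (metis imageE)

lemma opposite: "faithful_hom_associative A (\<lambda>x y. y \<star> x) \<alpha>"
proof
  show "a = b"
    if "a \<in> A" "b \<in> A" "\<And>x. x \<in> A \<Longrightarrow> a \<star> x = b \<star> x" "\<And>x. x \<in> A \<Longrightarrow> x \<star> a = x \<star> b"
    for a b
    by (rule faithful) (fact that)+
qed (simp_all add: star_closed \<alpha>_image hom_assoc)

lemma eq_if_tests_eq:
  assumes "a \<in> A" "b \<in> A"
    and "\<And>x. x \<in> A \<Longrightarrow> \<alpha> x \<star> a = \<alpha> x \<star> b"
    and "\<And>x. x \<in> A \<Longrightarrow> a \<star> \<alpha> x = b \<star> \<alpha> x"
  shows "a = b"
  using faithful[OF assms(1,2)] assms(3,4) \<alpha>_image by (metis imageE)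

text \<open>
  The law turns \<open>\<alpha> x\<close> into \<open>x\<close> only inside products with two further factors, so at first
  \<open>\<alpha> x = \<alpha> x'\<close> says only that \<open>x \<star> y\<close> and \<open>x' \<star> y\<close> agree when multiplied on the right. Their
  products from the left, \<open>\<alpha> v \<star> (x \<star> y) = (v \<star> x) \<star> \<alpha> y\<close>, contain \<open>x\<close> as an inner factor of a
  triple product bracketed either way. A test from the right therefore brings \<open>(x \<star> y) \<star> t\<close> into
  play, and a test from the left \<open>u \<star> (v \<star> x)\<close>, where \<open>x\<close> may be replaced by \<open>x'\<close>.
\<close>

lemma star_eq_if_\<alpha>_eq:
  assumes x: "x \<in> A" and x': "x' \<in> A" and eq: "\<alpha> x = \<alpha> x'" and y: "y \<in> A"
  shows "x \<star> y = x' \<star> y"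
proof (rule eq_if_tests_eq)
  note closed = star_closed \<alpha>_closed x x' y
  have right: "(x \<star> y) \<star> w = (x' \<star> y) \<star> w" if w: "w \<in> A" for w
  proof -
    obtain z where z: "z \<in> A" "w = \<alpha> z" using w by (rule preimage)
    have "(x \<star> y) \<star> \<alpha> z = \<alpha> x \<star> (y \<star> z)" using hom_assoc[OF x y z(1)] by (rule sym)
    also have "\<dots> = (x' \<star> y) \<star> \<alpha> z" unfolding eq by (rule hom_assoc[OF x' y z(1)])
    finally show ?thesis unfolding z(2) .
  qed
  have left: "w \<star> (v \<star> x) = w \<star> (v \<star> x')" if w: "w \<in> A" and v: "v \<in> A" for w v
  proof -
    obtain z where z: "z \<in> A" "w = \<alpha> z" using w by (rule preimage)
    have "\<alpha> z \<star> (v \<star> x) = (z \<star> v) \<star> \<alpha> x" by (rule hom_assoc[OF z(1) v x])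
    also have "\<dots> = \<alpha> z \<star> (v \<star> x')" unfolding eq by (rule hom_assoc[OF z(1) v x', symmetric])
    finally show ?thesis unfolding z(2) .
  qed
  show "x \<star> y \<in> A" "x' \<star> y \<in> A" by (simp_all add: closed)
  show "(x \<star> y) \<star> \<alpha> w = (x' \<star> y) \<star> \<alpha> w" if "w \<in> A" for w
    using that by (intro right \<alpha>_closed)
  show "\<alpha> v \<star> (x \<star> y) = \<alpha> v \<star> (x' \<star> y)" if v: "v \<in> A" for v
  proof -
    have "(v \<star> x) \<star> \<alpha> y = (v \<star> x') \<star> \<alpha> y"
    proof (rule eq_if_tests_eq)
      show "(v \<star> x) \<star> \<alpha> y \<in> A" "(v \<star> x') \<star> \<alpha> y \<in> A" by (simp_all add: closed v)
      show "\<alpha> u \<star> ((v \<star> x) \<star> \<alpha> y) = \<alpha> u \<star> ((v \<star> x') \<star> \<alpha> y)" if u: "u \<in> A" for u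
        using left[OF u v] by (simp add: hom_assoc closed u v)
      show "((v \<star> x) \<star> \<alpha> y) \<star> \<alpha> t = ((v \<star> x') \<star> \<alpha> y) \<star> \<alpha> t" if t: "t \<in> A" for t
        using right[OF t] by (simp add: hom_assoc[symmetric] closed t v)
    qed
    then show ?thesis by (simp add: hom_assoc x x' y v)
  qed
qed

lemma inj_on_\<alpha>: "inj_on \<alpha> A"
proof (rule inj_onI)
  interpret op: faithful_hom_associative A "\<lambda>x y. y \<star> x" \<alpha> by (rule opposite)
  fix x x' assume xx': "x \<in> A" "x' \<in> A" "\<alpha> x = \<alpha> x'"
  show "x = x'"
  proof (rule faithful[OF xx'(1,2)])
    fix y assume y: "y \<in> A"
    show "x \<star> y = x' \<star> y" using xx' y by (rule star_eq_if_\<alpha>_eq)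
    show "y \<star> x = y \<star> x'" using xx' y by (rule op.star_eq_if_\<alpha>_eq)
  qed
qed

end

section \<open>Associativity of the untwisted product\<close>

text \<open>
  The locale isolates what remains of the hom-associative law for \<open>x \<cdot> y = \<alpha>\<inverse> (x \<star> y)\<close>.
\<close>

locale faithful_untwisted =
  fixes A :: "'a set" and m :: "'a \<Rightarrow> 'a \<Rightarrow> 'a" (infixl "\<cdot>" 70) and \<alpha> :: "'a \<Rightarrow> 'a"
  assumes m_closed: "\<lbrakk>x \<in> A; y \<in> A\<rbrakk> \<Longrightarrow> x \<cdot> y \<in> A"
    and \<alpha>_image: "\<alpha> ` A = A"
    and inj_\<alpha>: "inj_on \<alpha> A"
    and bracket: "\<lbrakk>x \<in> A; y \<in> A; z \<in> A\<rbrakk> \<Longrightarrow> \<alpha> x \<cdot> \<alpha> (y \<cdot> z) = \<alpha> (x \<cdot> y) \<cdot> \<alpha> z"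
    and faithful: "\<lbrakk>a \<in> A; b \<in> A; \<And>x. x \<in> A \<Longrightarrow> x \<cdot> a = x \<cdot> b; \<And>x. x \<in> A \<Longrightarrow> a \<cdot> x = b \<cdot> x\<rbrakk>
      \<Longrightarrow> a = b"
begin

lemma \<alpha>_closed: "x \<in> A \<Longrightarrow> \<alpha> x \<in> A"
  using imageI[of x A \<alpha>] by (simp add: \<alpha>_image)

lemma preimage:
  assumes "w \<in> A"
  obtains z where "z \<in> A" "w = \<alpha> z"
  using assms \<alpha>_image by (metis imageE)

lemma opposite: "faithful_untwisted A (\<lambda>x y. y \<cdot> x) \<alpha>"
proof
  show "a = b"
    if "a \<in> A" "b \<in> A" "\<And>x. x \<in> A \<Longrightarrow> a \<cdot> x = b \<cdot> x" "\<And>x. x \<in> A \<Longrightarrow> x \<cdot> a = x \<cdot> b"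
    for a b
    by (rule faithful) (fact that)+
qed (simp_all add: m_closed \<alpha>_image inj_\<alpha> bracket)

lemma eq_if_tests_eq:
  assumes "a \<in> A" "b \<in> A"
    and "\<And>x. x \<in> A \<Longrightarrow> \<alpha> x \<cdot> a = \<alpha> x \<cdot> b"
    and "\<And>x. x \<in> A \<Longrightarrow> a \<cdot> \<alpha> x = b \<cdot> \<alpha> x"
  shows "a = b"
  using faithful[OF assms(1,2)] assms(3,4) \<alpha>_image by (metis imageE)

text \<open>
  The multiplier \<open>\<alpha> (\<alpha> v)\<close> makes the law applicable at two nesting depths: the outer one moves a
  factor across the product, the inner one regroups \<open>x y\<close> and \<open>z t\<close> around \<open>y z\<close>.
\<close>

lemma bracket_left_test:
  assumes v: "v \<in> A" and x: "x \<in> A" and y: "y \<in> A" and z: "z \<in> A" and t: "t \<in> A"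
  shows "\<alpha> (\<alpha> v) \<cdot> \<alpha> (\<alpha> (x \<cdot> y) \<cdot> \<alpha> (z \<cdot> t)) = \<alpha> (\<alpha> v) \<cdot> \<alpha> (\<alpha> (x \<cdot> (y \<cdot> z)) \<cdot> \<alpha> t)"
proof -
  note closed = m_closed \<alpha>_closed v x y z t
  have "\<alpha> (\<alpha> v) \<cdot> \<alpha> (\<alpha> (x \<cdot> y) \<cdot> \<alpha> (z \<cdot> t)) = \<alpha> (\<alpha> v \<cdot> \<alpha> (x \<cdot> y)) \<cdot> \<alpha> (\<alpha> (z \<cdot> t))"
    by (rule bracket) (simp_all add: closed)
  also have "\<dots> = \<alpha> (\<alpha> (v \<cdot> x) \<cdot> \<alpha> y) \<cdot> \<alpha> (\<alpha> (z \<cdot> t))"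
    using bracket[OF v x y] by simp
  also have "\<dots> = \<alpha> (\<alpha> (v \<cdot> x)) \<cdot> \<alpha> (\<alpha> y \<cdot> \<alpha> (z \<cdot> t))"
    by (rule bracket[symmetric]) (simp_all add: closed)
  also have "\<dots> = \<alpha> (\<alpha> (v \<cdot> x)) \<cdot> \<alpha> (\<alpha> (y \<cdot> z) \<cdot> \<alpha> t)"
    using bracket[OF y z t] by simp
  also have "\<dots> = \<alpha> (\<alpha> (v \<cdot> x) \<cdot> \<alpha> (y \<cdot> z)) \<cdot> \<alpha> (\<alpha> t)"
    by (rule bracket) (simp_all add: closed)
  also have "\<dots> = \<alpha> (\<alpha> v \<cdot> \<alpha> (x \<cdot> (y \<cdot> z))) \<cdot> \<alpha> (\<alpha> t)"
    using bracket[OF v x m_closed[OF y z]] by simp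
  also have "\<dots> = \<alpha> (\<alpha> v) \<cdot> \<alpha> (\<alpha> (x \<cdot> (y \<cdot> z)) \<cdot> \<alpha> t)"
    by (rule bracket[symmetric]) (simp_all add: closed)
  finally show ?thesis .
qed

lemma bracket_regroup:
  assumes x: "x \<in> A" and y: "y \<in> A" and z: "z \<in> A" and t: "t \<in> A"
  shows "\<alpha> (x \<cdot> y) \<cdot> \<alpha> (z \<cdot> t) = \<alpha> (x \<cdot> (y \<cdot> z)) \<cdot> \<alpha> t" (is "?E = ?F")
proof -
  interpret op: faithful_untwisted A "\<lambda>x y. y \<cdot> x" \<alpha> by (rule opposite)
  note closed = m_closed \<alpha>_closed x y z t
  (* The mirror image of the left test, read with t, z, y, x for x, y, z, t, produces the second
     product in this form. *)
  have F: "?F = \<alpha> x \<cdot> \<alpha> ((y \<cdot> z) \<cdot> t)"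
    by (rule bracket[symmetric]) (simp_all add: closed)
  have EF: "?E \<in> A" "?F \<in> A" by (simp_all add: closed)
  have "\<alpha> ?E = \<alpha> ?F"
  proof (rule eq_if_tests_eq)
    show "\<alpha> ?E \<in> A" "\<alpha> ?F \<in> A" using EF by (simp_all add: \<alpha>_closed)
    fix w assume "w \<in> A"
    then obtain v where v: "v \<in> A" "w = \<alpha> v" by (rule preimage)
    show "\<alpha> w \<cdot> \<alpha> ?E = \<alpha> w \<cdot> \<alpha> ?F"
      unfolding v(2) by (rule bracket_left_test[OF v(1) x y z t])
    show "\<alpha> ?E \<cdot> \<alpha> w = \<alpha> ?F \<cdot> \<alpha> w"
      unfolding v(2) F by (rule op.bracket_left_test[OF v(1) t z y x])
  qed
  then show ?thesis using inj_\<alpha> EF by (simp add: inj_on_eq_iff)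
qed

lemma assoc:
  assumes x: "x \<in> A" and y: "y \<in> A" and z: "z \<in> A"
  shows "(x \<cdot> y) \<cdot> z = x \<cdot> (y \<cdot> z)"
proof -
  interpret op: faithful_untwisted A "\<lambda>x y. y \<cdot> x" \<alpha> by (rule opposite)
  note closed = m_closed \<alpha>_closed x y z
  have right: "\<alpha> ((x \<cdot> y) \<cdot> z) \<cdot> \<alpha> t = \<alpha> (x \<cdot> (y \<cdot> z)) \<cdot> \<alpha> t" if t: "t \<in> A" for t
    using bracket[OF m_closed[OF x y] z t] bracket_regroup[OF x y z t] by simp
  have left: "\<alpha> t \<cdot> \<alpha> ((x \<cdot> y) \<cdot> z) = \<alpha> t \<cdot> \<alpha> (x \<cdot> (y \<cdot> z))" if t: "t \<in> A" for t
    using op.bracket[OF m_closed[OF y z] x t] op.bracket_regroup[OF z y x t] by simp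
  have "\<alpha> ((x \<cdot> y) \<cdot> z) = \<alpha> (x \<cdot> (y \<cdot> z))"
    by (rule eq_if_tests_eq) (simp_all add: closed left right)
  then show ?thesis using inj_\<alpha> by (simp add: inj_on_eq_iff closed)
qed

end

text \<open>
  Applying \<open>\<alpha>\<close> to the untwisted product gives back \<open>\<star>\<close>, so elements with equal translations for
  the former have equal translations for the latter, and non-degeneracy is inherited.
\<close>

lemma (in faithful_hom_associative) faithful_untwisted:
  "faithful_untwisted A (\<lambda>x y. inv_into A \<alpha> (x \<star> y)) \<alpha>"
proof
  have \<alpha>_inv: "\<alpha> (inv_into A \<alpha> a) = a" if "a \<in> A" for a
    using that \<alpha>_image by (simp add: f_inv_into_f)
  show "inv_into A \<alpha> (x \<star> y) \<in> A" if "x \<in> A" "y \<in> A" for x y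
    using star_closed[OF that] \<alpha>_image by (simp add: inv_into_into)
  show "\<alpha> ` A = A" by (rule \<alpha>_image)
  show "inj_on \<alpha> A" by (rule inj_on_\<alpha>)
  show "inv_into A \<alpha> (\<alpha> x \<star> \<alpha> (inv_into A \<alpha> (y \<star> z)))
      = inv_into A \<alpha> (\<alpha> (inv_into A \<alpha> (x \<star> y)) \<star> \<alpha> z)"
    if "x \<in> A" "y \<in> A" "z \<in> A" for x y z
    using that by (simp add: \<alpha>_inv star_closed hom_assoc)
  show "a = b"
    if a: "a \<in> A" and b: "b \<in> A"
      and l: "\<And>x. x \<in> A \<Longrightarrow> inv_into A \<alpha> (x \<star> a) = inv_into A \<alpha> (x \<star> b)"
      and r: "\<And>x. x \<in> A \<Longrightarrow> inv_into A \<alpha> (a \<star> x) = inv_into A \<alpha> (b \<star> x)" for a b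
  proof (rule faithful[OF a b])
    fix x assume x: "x \<in> A"
    show "x \<star> a = x \<star> b" using l[OF x] \<alpha>_inv star_closed x a b by metis
    show "a \<star> x = b \<star> x" using r[OF x] \<alpha>_inv star_closed x a b by metis
  qed
qed

theorem proposition1:
  fixes A :: "'a set" and star :: "'a \<Rightarrow> 'a \<Rightarrow> 'a" and \<alpha> :: "'a \<Rightarrow> 'a"
  assumes "hom_associative A star \<alpha>"
    and "\<alpha> ` A = A"
  shows "is_twist A star \<alpha> \<or> strongly_degenerate A star"
proof (rule disjCI)
  assume nondegenerate: "\<not> strongly_degenerate A star"
  interpret faithful_hom_associative A star \<alpha>
  proof
    show "star x y \<in> A" if "x \<in> A" "y \<in> A" for x y
      using assms(1) that unfolding hom_associative_def by blast
    show "\<alpha> ` A = A" by (rule assms(2))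
    show "star (\<alpha> x) (star y z) = star (star x y) (\<alpha> z)" if "x \<in> A" "y \<in> A" "z \<in> A" for x y z
      using assms(1) that unfolding hom_associative_def by blast
    show "a = b"
      if "a \<in> A" "b \<in> A"
        and "\<And>x. x \<in> A \<Longrightarrow> star x a = star x b" "\<And>x. x \<in> A \<Longrightarrow> star a x = star b x" for a b
      using nondegenerate that unfolding strongly_degenerate_def by metis
  qed
  let ?m = "\<lambda>x y. inv_into A \<alpha> (star x y)"
  interpret untwisted: faithful_untwisted A ?m \<alpha> by (rule faithful_untwisted)
  have "associative_on A ?m"
    by (simp add: associative_on_def Pi_iff untwisted.m_closed untwisted.assoc)
  moreover have "star x y = \<alpha> (?m x y)" if "x \<in> A" "y \<in> A" for x y
    using star_closed[OF that] \<alpha>_image by (simp add: f_inv_into_f)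
  ultimately show "is_twist A star \<alpha>"
    unfolding is_twist_def by (intro exI[of _ ?m] conjI ballI)
qed

end
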